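(* For all $|I|\in\mathbb N$, and under assumptions (A1)–(A4) of the context, there exist a prosumer $i\in I$ with true demand $\mathrm d_i$ and an under-report $\mathrm d_i'\in[0,\mathrm d_i]$ such that $$\mathbb E_{\mathrm d_{-i}\sim P_{-i}}\big[U_i^{\alpha}(\mathrm d_i;\mathrm d_i',\mathrm d_{-i})\big]-\mathbb E_{\mathrm d_{-i}\sim P_{-i}}\big[U_i^{\alpha}(\mathrm d_i;\mathrm d_i,\mathrm d_{-i})\big]\;\ge\;\varepsilon_i^{\alpha},$$ in expectation over all other bidders' bids $\mathrm d_{-i}$, where $\varepsilon_i^{\alpha}=\mathrm d_i\,(w\,q_i-\overline\beta_i)$ is independent of $(|I|,r,C,H,m,\kappa)$.
   Context: Day-ahead (DA) market. $I$ is a finite set of consumers; consumer $i$ has marginal value $v_i>0$ and private true demand $\mathrm d_i\in[0,\overline{\mathrm d}]$. The DA supply side is given by breakpoints $0=G_0<G_1<\dots<G_{|J|}$ and costs $0<c_0<c_1<\dots<c_{|J|}$, with piecewise constant inverse supply function $c(x)=c_j$ for $x\in[G_j,G_{j+1})$, $j=0,\dots,|J|-1$, and $c(G_{|J|})=c_{|J|}$; $H=\max_{0\le j\le |J|-1}|c_{j+1}-c_j|$. When $i$ reports $\mathrm d_i'\in[0,\mathrm d_i]$ and the others report $\mathrm d_{-i}=(\mathrm d_j)_{j\ne i}$, every consumer is allocated exactly its report and the DA price is $p^{DA}(\mathrm d_i',\mathrm d_{-i})=c\big(\mathrm d_i'+\sum_{j\neq i}\mathrm d_j\big)$. Real-time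 (RT) market. Units $j=1,\dots,n$ have costs $0<\overline c_1<\dots<\overline c_n$ and capacities $\overline g_j>0$; $\overline G_1=0$, $\overline G_{j+1}=\overline G_j+\overline g_j$, and $B_j=[\overline G_j,\overline G_{j+1})$. Actual total consumption $D$ is random; the imbalance is $\rho=D-\mathrm d_i'-\sum_{j\ne i}\mathrm d_j$, assumed to lie in $[0,\overline G_{n+1})$. If $\rho\in B_j$, the RT price is $p^{RT}(\rho)=\overline c_j$ and the dispatch is $y_l(\rho)=\overline g_l$ for $l<j$, $y_j(\rho)=\rho-\overline G_j$, $y_l(\rho)=0$ for $l>j$. For $\delta\in[0,\mathrm d_i]$ write $p^{RT}(\delta,\mathrm d_{-i})=\mathbb E\big[p^{RT}\big(D-(\mathrm d_i-\delta)-\sum_{j\neq i}\mathrm d_j\big)\,\big|\,\mathrm d_{-i}\big]$. Utilities. A consumer with true demand $\mathrm d_i$ reporting $\mathrm d_i'$ gets $$U_i(\mathrm d_i;\mathrm d_i',\mathrm d_{-i})=v_i\mathrm d_i-p^{DA}(\mathrm d_i',\mathrm d_{-i})\,\mathrm d_i'-p^{RT}(\rho)(\mathrm d_i-\mathrm d_i').$$ A prosumer is a consumer $i$ who owns shares $\alpha_{il}\ge0$, $\sum_l\alpha_{il}=1$, of the RT units; its utility is $$U_i^\alpha(\mathrm d_i;\mathrm d_i',\mathrm d_{-i})=U_i(\mathrm d_i;\mathrm d_i',\mathrm d_{-i})+\sum_{l=1}^n\alpha_{il}\,\big(p^{RT}(\rho)-\overline c_l\big)\,y_l(\rho).$$ Both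 depend also on $D$ through $\rho$; the expectations in the claim also average over $D$ according to player $i$'s belief. Beliefs. Player $i$ holds a belief $P_i$, a joint law of $(\mathrm d_{-i},D)$ with $\mathrm d_{-i}$-marginal $P_{-i}$, under which the $\mathrm d_j$, $j\neq i$, are independent with values in $[0,\overline{\mathrm d}]$; all expectations and probabilities are with respect to it. Quantities in the bound. $\overline\beta_i=\max_{\delta\in[0,\mathrm d_i]}\mathbb E\big[p^{RT}(\delta,\mathrm d_{-i})\big]$ is the maximum expected RT price that $i$ can induce by under-reporting. $w$ is the cost gap between consecutive RT bins times the capacity of the prosumer's RT asset: if that asset is unit $j_0$, $w=(\overline c_{j_0+1}-\overline c_{j_0})\,\overline g_{j_0}$. $q_i>0$ is the rate, per unit of demand, at which boundary-crossing scenarios are activated: $\Pr\big(\overline G_{j_0+1}-\mathrm d_i\le\rho_0<\overline G_{j_0+1}\big)\ge q_i\,\mathrm d_i$, where $\rho_0=D-\mathrm d_i-\sum_{j\ne i}\mathrm d_j$ is the imbalance under truthful reporting. Assumptions. (A1) Certain allocation: $\mathrm d_i+\sum_{j\ne i}\mathrm d_j\le G_{|J|}$ almost surely, so that $i$ is allocated with probability one. (A2) RT is more expensive than DA: $\mathbb E\big[p^{DA}(\mathrm d_i,\mathrm d_{-i})-p^{RT}(0,\mathrm d_{-i})\big]\le 0$. (A3) There are $l>0$ and $\kappa\in(0,1]$ such that for at least $m$ players $j\in I\setminus\{i\}$, $\sup_{x\in\mathbb R}\Pr(\mathrm d_j\in[x,x+l])\le 1-\kappa$. (A4) There is $r\in(0,1]$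 with $m\ge r|I|$. $C$ denotes the universal constant in the Kolmogorov–Rogozin concentration inequality. *)

theory Defs
  imports "HOL-Probability.Probability"
begin

section \<open>Day-ahead market\<close>

record da_market =
  da_size :: nat
  da_brk  :: "nat \<Rightarrow> real"
  da_cost :: "nat \<Rightarrow> real"

definition da_wf :: "da_market \<Rightarrow> bool" where
  "da_wf A \<longleftrightarrow> 1 \<le> da_size A
     \<and> da_brk A 0 = 0 \<and> strict_mono_on {0..da_size A} (da_brk A)
     \<and> 0 < da_cost A 0 \<and> strict_mono_on {0..da_size A} (da_cost A)"

text \<open>Inverse supply function; outside the supply range, which the certain allocation
  assumption excludes almost surely, its value is the dummy value 0.\<close>

definition da_inv_supply :: "da_market \<Rightarrow> real \<Rightarrow> real" where
  "da_inv_supply A x =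
     (\<Sum>j<da_size A. da_cost A j * indicator {da_brk A j..<da_brk A (Suc j)} x)
     + da_cost A (da_size A) * indicator {da_brk A (da_size A)} x"

definition da_price :: "da_market \<Rightarrow> 'i set \<Rightarrow> 'i \<Rightarrow> real \<Rightarrow> ('i \<Rightarrow> real) \<Rightarrow> real" where
  "da_price A I i d' x = da_inv_supply A (d' + (\<Sum>j\<in>I - {i}. x j))"


section \<open>Real-time market\<close>

text \<open>Units are numbered from 1.\<close>

record rt_market =
  rt_size :: nat
  rt_cost :: "nat \<Rightarrow> real"
  rt_cap  :: "nat \<Rightarrow> real"

definition rt_wf :: "rt_market \<Rightarrow> bool" where
  "rt_wf R \<longleftrightarrow> (\<forall>j\<in>{1..rt_size R}. 0 < rt_cost R j \<and> 0 < rt_cap R j)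
     \<and> strict_mono_on {1..rt_size R} (rt_cost R)"

definition rt_brk :: "rt_market \<Rightarrow> nat \<Rightarrow> real" where
  "rt_brk R j = (\<Sum>k\<in>{1..<j}. rt_cap R k)"

definition rt_bin :: "rt_market \<Rightarrow> nat \<Rightarrow> real set" where
  "rt_bin R j = {rt_brk R j..<rt_brk R (j + 1)}"

text \<open>The bins are disjoint, so for an imbalance in bin \<open>j\<close> only the \<open>j\<close>-th summand
  survives in the next two sums. Imbalances outside all bins get the dummy value 0.\<close>

definition rt_price :: "rt_market \<Rightarrow> real \<Rightarrow> real" where
  "rt_price R \<rho> = (\<Sum>j=1..rt_size R. rt_cost R j * indicator (rt_bin R j) \<rho>)"

definition rt_dispatch :: "rt_market \<Rightarrow> nat \<Rightarrow> real \<Rightarrow> real" where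
  "rt_dispatch R l \<rho> =
     (\<Sum>j=1..rt_size R.
        (if l < j then rt_cap R l else if l = j then \<rho> - rt_brk R j else 0)
        * indicator (rt_bin R j) \<rho>)"

definition imbalance :: "'i set \<Rightarrow> 'i \<Rightarrow> real \<Rightarrow> ('i \<Rightarrow> real) \<Rightarrow> real \<Rightarrow> real" where
  "imbalance I i d' x D = D - d' - (\<Sum>j\<in>I - {i}. x j)"


section \<open>Utilities\<close>

definition utility ::
  "da_market \<Rightarrow> rt_market \<Rightarrow> 'i set \<Rightarrow> 'i \<Rightarrow> real \<Rightarrow> real \<Rightarrow> real \<Rightarrow> ('i \<Rightarrow> real) \<Rightarrow> real \<Rightarrow> real" where
  "utility A R I i v d d' x D =
     v * d - da_price A I i d' x * d' - rt_price R (imbalance I i d' x D) * (d - d')"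

definition prosumer :: "rt_market \<Rightarrow> (nat \<Rightarrow> real) \<Rightarrow> bool" where
  "prosumer R a \<longleftrightarrow> (\<forall>l\<in>{1..rt_size R}. 0 \<le> a l) \<and> (\<Sum>l=1..rt_size R. a l) = 1"

definition prosumer_utility ::
  "da_market \<Rightarrow> rt_market \<Rightarrow> 'i set \<Rightarrow> 'i \<Rightarrow> (nat \<Rightarrow> real) \<Rightarrow> real \<Rightarrow> real \<Rightarrow> real
     \<Rightarrow> ('i \<Rightarrow> real) \<Rightarrow> real \<Rightarrow> real" where
  "prosumer_utility A R I i a v d d' x D = utility A R I i v d d' x D
     + (\<Sum>l=1..rt_size R. a l * (rt_price R (imbalance I i d' x D) - rt_cost R l)
          * rt_dispatch R l (imbalance I i d' x D))"


section \<open>Beliefs\<close>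

text \<open>A belief of player \<open>i\<close> is a joint law of the other players' demands
  (first component) and the total consumption (second component).\<close>

definition belief ::
  "'i set \<Rightarrow> 'i \<Rightarrow> real \<Rightarrow> (('i \<Rightarrow> real) \<times> real) measure \<Rightarrow> bool" where
  "belief I i dmax P \<longleftrightarrow> prob_space P
     \<and> sets P = sets (PiM (I - {i}) (\<lambda>_. borel) \<Otimes>\<^sub>M borel)
     \<and> prob_space.indep_vars P (\<lambda>_. borel) (\<lambda>j \<omega>. fst \<omega> j) (I - {i})
     \<and> (\<forall>j\<in>I - {i}. AE \<omega> in P. fst \<omega> j \<in> {0..dmax})"

definition others_algebra ::
  "'i set \<Rightarrow> 'i \<Rightarrow> (('i \<Rightarrow> real) \<times> real) measure \<Rightarrow> (('i \<Rightarrow> real) \<times> real) measure" where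
  "others_algebra I i P = vimage_algebra (space P) fst (PiM (I - {i}) (\<lambda>_. borel))"

text \<open>RT price when \<open>i\<close> under-reports by \<open>\<delta>\<close>, conditional on the others' demands.\<close>

definition cond_rt_price ::
  "rt_market \<Rightarrow> 'i set \<Rightarrow> 'i \<Rightarrow> real \<Rightarrow> (('i \<Rightarrow> real) \<times> real) measure \<Rightarrow> real
     \<Rightarrow> ('i \<Rightarrow> real) \<times> real \<Rightarrow> real" where
  "cond_rt_price R I i d P \<delta> = real_cond_exp P (others_algebra I i P)
     (\<lambda>(x, D). rt_price R (imbalance I i (d - \<delta>) x D))"

definition expected_utility ::
  "da_market \<Rightarrow> rt_market \<Rightarrow> 'i set \<Rightarrow> 'i \<Rightarrow> (nat \<Rightarrow> real) \<Rightarrow> real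
     \<Rightarrow> (('i \<Rightarrow> real) \<times> real) measure \<Rightarrow> real \<Rightarrow> real \<Rightarrow> real" where
  "expected_utility A R I i a v P d d' =
     (\<integral>(x, D). prosumer_utility A R I i a v d d' x D \<partial>P)"


section \<open>Assumptions\<close>

definition certain_allocation ::
  "da_market \<Rightarrow> 'i set \<Rightarrow> 'i \<Rightarrow> real \<Rightarrow> (('i \<Rightarrow> real) \<times> real) measure \<Rightarrow> bool" where
  "certain_allocation A I i d P \<longleftrightarrow>
     (AE \<omega> in P. d + (\<Sum>j\<in>I - {i}. fst \<omega> j) \<le> da_brk A (da_size A))"

definition rt_more_expensive ::
  "da_market \<Rightarrow> rt_market \<Rightarrow> 'i set \<Rightarrow> 'i \<Rightarrow> real \<Rightarrow> (('i \<Rightarrow> real) \<times> real) measure \<Rightarrow> bool" where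
  "rt_more_expensive A R I i d P \<longleftrightarrow>
     (\<integral>\<omega>. da_price A I i d (fst \<omega>) - cond_rt_price R I i d P 0 \<omega> \<partial>P) \<le> 0"

definition spread_demands ::
  "'i set \<Rightarrow> 'i \<Rightarrow> (('i \<Rightarrow> real) \<times> real) measure \<Rightarrow> nat \<Rightarrow> real \<Rightarrow> real \<Rightarrow> bool" where
  "spread_demands I i P m l \<kappa> \<longleftrightarrow>
     m \<le> card {j \<in> I - {i}. (SUP t. measure P {\<omega> \<in> space P. fst \<omega> j \<in> {t..t + l}}) \<le> 1 - \<kappa>}"

definition imbalance_in_range ::
  "rt_market \<Rightarrow> 'i set \<Rightarrow> 'i \<Rightarrow> real \<Rightarrow> (('i \<Rightarrow> real) \<times> real) measure \<Rightarrow> bool" where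
  "imbalance_in_range R I i d P \<longleftrightarrow>
     (\<forall>d'\<in>{0..d}. AE \<omega> in P.
        imbalance I i d' (fst \<omega>) (snd \<omega>) \<in> {0..<rt_brk R (rt_size R + 1)})"


section \<open>Quantities in the bound\<close>

text \<open>The supremum is a maximum, attained at \<open>\<delta> = d\<close>, when the imbalance is in range:
  the RT price is nondecreasing in the imbalance.\<close>

definition beta_max ::
  "rt_market \<Rightarrow> 'i set \<Rightarrow> 'i \<Rightarrow> real \<Rightarrow> (('i \<Rightarrow> real) \<times> real) measure \<Rightarrow> real" where
  "beta_max R I i d P = (SUP \<delta>\<in>{0..d}. \<integral>\<omega>. cond_rt_price R I i d P \<delta> \<omega> \<partial>P)"

definition gap_value :: "rt_market \<Rightarrow> nat \<Rightarrow> real" where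
  "gap_value R j = (rt_cost R (j + 1) - rt_cost R j) * rt_cap R j"

definition crossing_prob ::
  "rt_market \<Rightarrow> 'i set \<Rightarrow> 'i \<Rightarrow> nat \<Rightarrow> real \<Rightarrow> (('i \<Rightarrow> real) \<times> real) measure \<Rightarrow> real" where
  "crossing_prob R I i j d P = measure P {\<omega> \<in> space P.
     imbalance I i d (fst \<omega>) (snd \<omega>) \<in> {rt_brk R (j + 1) - d..<rt_brk R (j + 1)}}"

text \<open>The bound depends on the market only through these four numbers: the number of players,
  the DA supply steps and the constants of the spread assumption do not enter.\<close>

definition eps_prosumer :: "real \<Rightarrow> real \<Rightarrow> real \<Rightarrow> real \<Rightarrow> real" where
  "eps_prosumer d w q \<beta> = d * (w * q - \<beta>)"

end

(* The prosumer reports nothing, d' = 0. Nonnegativity of the DA price makes its DA payment under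
   truthful reporting a saving, and its RT payment is at most d times the maximal expected RT price.
   Unit j0 earns nothing while the imbalance stays below the upper end of its bin and at least its
   gap value above it, with a profit that is monotone in the imbalance. Moving the imbalance up by d
   thus raises the profit by at least the gap value on the crossing event and never lowers it. *)

theory Submission
  imports Defs
begin

subsection \<open>Day-ahead prices\<close>

lemma da_cost_pos:
  assumes "da_wf A" "j \<le> da_size A"
  shows "0 < da_cost A j"
proof (cases "j = 0")
  case False
  then have "da_cost A 0 < da_cost A j"
    using assms by (auto simp: da_wf_def intro: strict_mono_onD)
  then show ?thesis
    using assms(1) by (simp add: da_wf_def)
qed (use assms in \<open>auto simp: da_wf_def\<close>)

text \<open>Each summand is a positive cost times an indicator, so the sign is right for every
  \<open>x\<close>, including the dummy value 0 outside the supply range.\<close>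

lemma da_inv_supply_nonneg:
  assumes "da_wf A"
  shows "0 \<le> da_inv_supply A x"
  unfolding da_inv_supply_def
  by (intro add_nonneg_nonneg sum_nonneg mult_nonneg_nonneg)
     (auto intro!: less_imp_le da_cost_pos[OF assms])

text \<open>A crude bound obtained by dropping all indicators; it serves the integrability of the DA
  price.\<close>

lemma da_inv_supply_le:
  assumes "da_wf A"
  shows "da_inv_supply A x \<le> (\<Sum>j\<le>da_size A. da_cost A j)"
proof -
  have le: "c * indicator S x \<le> c" if "0 < c" for c :: real and S :: "real set"
    using that by (simp add: indicator_def)
  then have "da_inv_supply A x \<le> (\<Sum>j<da_size A. da_cost A j) + da_cost A (da_size A)"
    unfolding da_inv_supply_def
    by (intro add_mono sum_mono) (auto intro!: le da_cost_pos[OF assms])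
  then show ?thesis
    by (simp add: lessThan_Suc_atMost[symmetric])
qed

lemma measurable_da_inv_supply [measurable]: "da_inv_supply A \<in> borel_measurable borel"
  unfolding da_inv_supply_def[abs_def] by measurable


subsection \<open>Real-time prices and dispatch\<close>

text \<open>Capacities are positive for the units \<open>1..rt_size R\<close>, and
  \<open>rt_brk R k\<close> adds up those below \<open>k\<close>; hence the range up to
  \<open>rt_size R + 1\<close>.\<close>

lemma rt_brk_mono:
  assumes "rt_wf R" "j \<le> k" "k \<le> rt_size R + 1"
  shows "rt_brk R j \<le> rt_brk R k"
  unfolding rt_brk_def
  by (rule sum_mono2) (use assms in \<open>auto simp: rt_wf_def less_imp_le\<close>)

lemma rt_brk_Suc:
  assumes "1 \<le> j"
  shows "rt_brk R (Suc j) = rt_brk R j + rt_cap R j"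
  unfolding rt_brk_def using assms by (simp add: sum.atLeastLessThan_Suc)

text \<open>The bins tile the interval from 0 to the last break. Induction on their number: a point
  not below the lower end of the last bin lies in that bin.\<close>

lemma rt_bin_exists:
  assumes "0 \<le> \<rho>" "\<rho> < rt_brk R (rt_size R + 1)"
  obtains k where "k \<in> {1..rt_size R}" "\<rho> \<in> rt_bin R k"
proof -
  have "\<exists>k\<in>{1..n}. \<rho> \<in> rt_bin R k" if "\<rho> < rt_brk R (n + 1)" for n
    using that
  proof (induction n)
    case 0
    \<comment> \<open>\<open>rt_brk R 1\<close> is an empty sum, so the premise would make
      \<open>\<rho>\<close> negative.\<close>
    then show ?case using assms(1) by (simp add: rt_brk_def)
  next
    case (Suc n)
    show ?case
    proof (cases "\<rho> < rt_brk R (n + 1)")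
      case True
      then show ?thesis using Suc.IH by force
    next
      case False
      then show ?thesis
        using Suc.prems by (intro bexI[of _ "Suc n"]) (auto simp: rt_bin_def)
    qed
  qed
  then show ?thesis using assms(2) that by blast
qed

text \<open>Otherwise bin \<open>k\<close> would end before bin \<open>j\<close> begins. With
  \<open>\<rho> = \<sigma>\<close>, applied in both directions, this yields disjointness of the
  bins.\<close>

lemma rt_bin_index_mono:
  assumes "rt_wf R" "k \<le> rt_size R" "\<rho> \<in> rt_bin R j" "\<sigma> \<in> rt_bin R k" "\<rho> \<le> \<sigma>" "j \<le> rt_size R"
  shows "j \<le> k"
proof (rule ccontr)
  assume "\<not> j \<le> k"
  then have "rt_brk R (k + 1) \<le> rt_brk R j"
    using assms by (intro rt_brk_mono) auto
  then show False using assms by (auto simp: rt_bin_def)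
qed

text \<open>By disjointness only one indicator is nonzero. The weights \<open>g\<close> are
  arbitrary so that prices and dispatches are both covered.\<close>

lemma sum_indicator_rt_bin:
  fixes g :: "nat \<Rightarrow> real"
  assumes "rt_wf R" "k \<in> {1..rt_size R}" "\<rho> \<in> rt_bin R k"
  shows "(\<Sum>j=1..rt_size R. g j * indicator (rt_bin R j) \<rho>) = g k"
proof -
  have "(\<Sum>j=1..rt_size R. g j * indicator (rt_bin R j) \<rho>)
      = (\<Sum>j=1..rt_size R. if j = k then g k else 0)"
    using assms
    by (intro sum.cong) (auto simp: indicator_def intro!: order_antisym rt_bin_index_mono[OF assms(1)])
  then show ?thesis using assms(2) by simp
qed

lemma rt_price_bin:
  assumes "rt_wf R" "k \<in> {1..rt_size R}" "\<rho> \<in> rt_bin R k"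
  shows "rt_price R \<rho> = rt_cost R k"
  unfolding rt_price_def by (rule sum_indicator_rt_bin[OF assms])

lemma rt_dispatch_bin:
  assumes "rt_wf R" "k \<in> {1..rt_size R}" "\<rho> \<in> rt_bin R k"
  shows "rt_dispatch R l \<rho> =
    (if l < k then rt_cap R l else if l = k then \<rho> - rt_brk R k else 0)"
  unfolding rt_dispatch_def by (rule sum_indicator_rt_bin[OF assms])

lemma rt_cost_mono:
  assumes "rt_wf R" "j \<le> k" "j \<in> {1..rt_size R}" "k \<in> {1..rt_size R}"
  shows "rt_cost R j \<le> rt_cost R k"
  using assms unfolding rt_wf_def
  by (meson strict_mono_on_leD)

lemma rt_price_mono:
  assumes "rt_wf R" "0 \<le> \<rho>" "\<rho> \<le> \<sigma>" "\<sigma> < rt_brk R (rt_size R + 1)"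
  shows "rt_price R \<rho> \<le> rt_price R \<sigma>"
proof -
  obtain j where j: "j \<in> {1..rt_size R}" "\<rho> \<in> rt_bin R j"
    using rt_bin_exists[of \<rho> R] assms by force
  obtain k where k: "k \<in> {1..rt_size R}" "\<sigma> \<in> rt_bin R k"
    using rt_bin_exists[of \<sigma> R] assms by force
  have "j \<le> k"
    using rt_bin_index_mono[OF assms(1)] j k assms(3) by auto
  then show ?thesis
    using rt_price_bin[OF assms(1) j] rt_price_bin[OF assms(1) k] rt_cost_mono[OF assms(1)] j k
    by simp
qed

text \<open>A bound uniform in \<open>\<rho>\<close>: it makes prices integrable under a belief and
  the supremum in \<open>beta_max\<close> finite.\<close>

lemma rt_price_abs_le: "\<bar>rt_price R \<rho>\<bar> \<le> (\<Sum>j=1..rt_size R. \<bar>rt_cost R j\<bar>)"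
  unfolding rt_price_def
  by (rule order_trans[OF sum_abs sum_mono]) (auto simp: indicator_def)

lemma rt_dispatch_abs_le:
  assumes "rt_wf R" "l \<in> {1..rt_size R}"
  shows "\<bar>rt_dispatch R l \<rho>\<bar> \<le> rt_cap R l"
proof (cases "\<exists>k\<in>{1..rt_size R}. \<rho> \<in> rt_bin R k")
  case True
  then obtain k where k: "k \<in> {1..rt_size R}" "\<rho> \<in> rt_bin R k" by blast
  then show ?thesis
    using assms rt_dispatch_bin[OF assms(1) k, of l] rt_brk_Suc[of k R]
    by (auto simp: rt_wf_def rt_bin_def less_imp_le)
next
  case False
  \<comment> \<open>Outside all bins the dispatch takes its dummy value 0.\<close>
  then have "rt_dispatch R l \<rho> = 0"
    unfolding rt_dispatch_def by (intro sum.neutral) auto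
  then show ?thesis using assms by (simp add: rt_wf_def less_imp_le)
qed

lemma measurable_rt_price [measurable]: "rt_price R \<in> borel_measurable borel"
  unfolding rt_price_def[abs_def] rt_bin_def by measurable

lemma measurable_rt_dispatch [measurable]: "rt_dispatch R l \<in> borel_measurable borel"
  unfolding rt_dispatch_def[abs_def] rt_bin_def by measurable


subsection \<open>Profit of a single unit\<close>

text \<open>The asset income of a prosumer whose whole share lies in unit \<open>l\<close>.\<close>

definition unit_profit :: "rt_market \<Rightarrow> nat \<Rightarrow> real \<Rightarrow> real" where
  "unit_profit R l \<rho> = (rt_price R \<rho> - rt_cost R l) * rt_dispatch R l \<rho>"

lemma measurable_unit_profit [measurable]: "unit_profit R l \<in> borel_measurable borel"
  unfolding unit_profit_def[abs_def] by measurable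

lemma unit_profit_abs_le:
  assumes "rt_wf R" "l \<in> {1..rt_size R}"
  shows "\<bar>unit_profit R l \<rho>\<bar>
    \<le> ((\<Sum>j=1..rt_size R. \<bar>rt_cost R j\<bar>) + \<bar>rt_cost R l\<bar>) * rt_cap R l"
  unfolding unit_profit_def abs_mult
  using rt_price_abs_le[of R \<rho>]
  by (intro mult_mono rt_dispatch_abs_le[OF assms]) auto

text \<open>Either unit \<open>l\<close> is marginal and the price equals its own cost, or a cheaper
  unit is marginal and unit \<open>l\<close> is not dispatched.\<close>

lemma unit_profit_below:
  assumes "rt_wf R" "l \<in> {1..rt_size R}" "0 \<le> \<rho>" "\<rho> < rt_brk R (l + 1)"
  shows "unit_profit R l \<rho> = 0"
proof -
  have "\<rho> < rt_brk R (rt_size R + 1)"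
    using rt_brk_mono[OF assms(1), of "l + 1" "rt_size R + 1"] assms by auto
  then obtain k where k: "k \<in> {1..rt_size R}" "\<rho> \<in> rt_bin R k"
    using rt_bin_exists[of \<rho> R] assms by blast
  have "k \<le> l"
  proof (rule ccontr)
    assume "\<not> k \<le> l"
    then have "rt_brk R (l + 1) \<le> rt_brk R k"
      using rt_brk_mono[OF assms(1), of "l + 1" k] k by auto
    then show False using assms k by (auto simp: rt_bin_def)
  qed
  then show ?thesis
    using rt_price_bin[OF assms(1) k] rt_dispatch_bin[OF assms(1) k, of l]
    by (auto simp: unit_profit_def)
qed

text \<open>The marginal unit now comes after \<open>l\<close>, so \<open>l\<close> runs at full
  capacity and the price is at least the next cost. Unit \<open>l + 1\<close> exists because
  \<open>l < rt_size R\<close>.\<close>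

lemma unit_profit_above:
  assumes "rt_wf R" "l \<in> {1..<rt_size R}"
    and "rt_brk R (l + 1) \<le> \<rho>" "\<rho> < rt_brk R (rt_size R + 1)"
  shows "unit_profit R l \<rho> = (rt_price R \<rho> - rt_cost R l) * rt_cap R l"
    and "rt_cost R (l + 1) \<le> rt_price R \<rho>"
proof -
  have "0 \<le> rt_brk R (l + 1)"
    unfolding rt_brk_def using assms by (intro sum_nonneg) (auto simp: rt_wf_def less_imp_le)
  then obtain k where k: "k \<in> {1..rt_size R}" "\<rho> \<in> rt_bin R k"
    using rt_bin_exists[of \<rho> R] assms by auto
  have "l < k"
  proof (rule ccontr)
    assume "\<not> l < k"
    then have "rt_brk R (k + 1) \<le> rt_brk R (l + 1)"
      using rt_brk_mono[OF assms(1), of "k + 1" "l + 1"] assms by auto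
    then show False using assms k by (auto simp: rt_bin_def)
  qed
  then show "unit_profit R l \<rho> = (rt_price R \<rho> - rt_cost R l) * rt_cap R l"
    using rt_dispatch_bin[OF assms(1) k, of l] by (simp add: unit_profit_def)
  show "rt_cost R (l + 1) \<le> rt_price R \<rho>"
    using rt_price_bin[OF assms(1) k] rt_cost_mono[OF assms(1), of "l + 1" k] \<open>l < k\<close> assms k
    by auto
qed

text \<open>The indicator marks the imbalances that a shift by \<open>\<delta>\<close> carries from
  below the upper end of bin \<open>l\<close> to that end or beyond.\<close>

lemma unit_profit_crossing:
  assumes R: "rt_wf R" and l: "l \<in> {1..<rt_size R}"
    and \<rho>: "0 \<le> \<rho>" "0 \<le> \<delta>" "\<rho> + \<delta> < rt_brk R (rt_size R + 1)"
  shows "gap_value R l * indicator {rt_brk R (l + 1) - \<delta>..<rt_brk R (l + 1)} \<rho>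
    \<le> unit_profit R l (\<rho> + \<delta>) - unit_profit R l \<rho>"
proof -
  have l': "l \<in> {1..rt_size R}" and cap: "0 \<le> rt_cap R l"
    using R l by (auto simp: rt_wf_def less_imp_le)
  \<comment> \<open>Before the break both profits vanish; on crossing, the profit jumps from 0 to at
    least the gap value; past the break both run at full capacity and the price is monotone.\<close>
  consider "\<rho> + \<delta> < rt_brk R (l + 1)"
    | "\<rho> < rt_brk R (l + 1)" "rt_brk R (l + 1) \<le> \<rho> + \<delta>"
    | "rt_brk R (l + 1) \<le> \<rho>"
    by linarith
  then show ?thesis
  proof cases
    case 1
    then show ?thesis
      using unit_profit_below[OF R l'] \<rho> by (simp add: indicator_def)
  next
    case 2
    have "gap_value R l \<le> unit_profit R l (\<rho> + \<delta>)"
      using unit_profit_above[OF R l 2(2) \<rho>(3)] cap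
      by (simp add: gap_value_def mult_right_mono)
    then show ?thesis
      using unit_profit_below[OF R l'] 2 \<rho> by (simp add: indicator_def)
  next
    case 3
    then have "unit_profit R l \<rho> \<le> unit_profit R l (\<rho> + \<delta>)"
      using unit_profit_above(1)[OF R l, of \<rho>] unit_profit_above(1)[OF R l, of "\<rho> + \<delta>"]
        rt_price_mono[OF R, of \<rho> "\<rho> + \<delta>"] \<rho> cap
      by (simp add: mult_right_mono)
    then show ?thesis
      using 3 by (simp add: indicator_def)
  qed
qed

text \<open>Nonnegative shares with total 1, one of which is already 1, leave 0 for every other
  unit.\<close>

lemma prosumer_utility_single_unit:
  assumes "prosumer R a" "l \<in> {1..rt_size R}" "a l = 1"
  shows "prosumer_utility A R I i a v d d' x D
    = utility A R I i v d d' x D + unit_profit R l (imbalance I i d' x D)"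
proof -
  have "(\<Sum>k\<in>{1..rt_size R} - {l}. a k) = 0"
    using assms sum.remove[of "{1..rt_size R}" l a] by (simp add: prosumer_def)
  then have zero: "a k = 0" if "k \<in> {1..rt_size R} - {l}" for k
    using that assms(1) sum_nonneg_eq_0_iff[of "{1..rt_size R} - {l}" a]
    by (simp add: prosumer_def)
  have "(\<Sum>k=1..rt_size R. a k * (rt_price R \<rho> - rt_cost R k) * rt_dispatch R k \<rho>)
      = unit_profit R l \<rho>" for \<rho>
    using assms(2,3) zero by (subst sum.remove[of _ l]) (auto simp: unit_profit_def)
  then show ?thesis
    by (simp add: prosumer_utility_def)
qed


subsection \<open>Expectations under a belief\<close>

lemma measurable_belief_coordinates:
  assumes "belief I i dmax P"
  shows "fst \<in> P \<rightarrow>\<^sub>M PiM (I - {i}) (\<lambda>_. borel)" "snd \<in> borel_measurable P"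
    and "\<And>j. j \<in> I - {i} \<Longrightarrow> (\<lambda>\<omega>. fst \<omega> j) \<in> borel_measurable P"
proof -
  have P: "sets P = sets (PiM (I - {i}) (\<lambda>_. borel) \<Otimes>\<^sub>M borel)"
    using assms by (simp add: belief_def)
  show fst: "fst \<in> P \<rightarrow>\<^sub>M PiM (I - {i}) (\<lambda>_. borel)"
    by (simp add: measurable_cong_sets[OF P refl])
  show "snd \<in> borel_measurable P"
    by (simp add: measurable_cong_sets[OF P refl])
  show "(\<lambda>\<omega>. fst \<omega> j) \<in> borel_measurable P" if "j \<in> I - {i}" for j
    by (rule measurable_compose[OF fst measurable_component_singleton[OF that]])
qed

lemma measurable_imbalance:
  assumes "belief I i dmax P"
  shows "(\<lambda>\<omega>. imbalance I i d' (fst \<omega>) (snd \<omega>)) \<in> borel_measurable P"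
proof -
  note [measurable] = measurable_belief_coordinates[OF assms]
  show ?thesis unfolding imbalance_def by measurable
qed

lemma integrable_rt_price_imbalance:
  assumes "belief I i dmax P"
  shows "integrable P (\<lambda>\<omega>. rt_price R (imbalance I i d' (fst \<omega>) (snd \<omega>)))"
proof -
  interpret prob_space P using assms by (simp add: belief_def)
  note [measurable] = measurable_imbalance[OF assms]
  show ?thesis
    by (rule integrable_const_bound[OF AE_I2])
       (unfold real_norm_def, rule rt_price_abs_le, measurable)
qed

lemma integrable_unit_profit_imbalance:
  assumes "belief I i dmax P" "rt_wf R" "l \<in> {1..rt_size R}"
  shows "integrable P (\<lambda>\<omega>. unit_profit R l (imbalance I i d' (fst \<omega>) (snd \<omega>)))"
proof -
  interpret prob_space P using assms by (simp add: belief_def)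
  note [measurable] = measurable_imbalance[OF assms(1)]
  show ?thesis
    by (rule integrable_const_bound) (auto intro: unit_profit_abs_le[OF assms(2,3)])
qed

lemma integrable_da_price:
  assumes "belief I i dmax P" "da_wf A"
  shows "integrable P (\<lambda>\<omega>. da_price A I i d' (fst \<omega>))"
proof -
  interpret prob_space P using assms by (simp add: belief_def)
  note [measurable] = measurable_belief_coordinates[OF assms(1)]
  have "\<bar>da_inv_supply A x\<bar> \<le> (\<Sum>j\<le>da_size A. da_cost A j)" for x
    using da_inv_supply_nonneg[OF assms(2), of x] da_inv_supply_le[OF assms(2), of x] by simp
  then show ?thesis
    unfolding da_price_def by (intro integrable_const_bound) auto
qed

lemma integrable_utility:
  assumes "belief I i dmax P" "da_wf A"
  shows "integrable P (\<lambda>\<omega>. utility A R I i v d d' (fst \<omega>) (snd \<omega>))"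
proof -
  interpret prob_space P using assms by (simp add: belief_def)
  show ?thesis
    unfolding utility_def
    by (intro Bochner_Integration.integrable_diff integrable_mult_left integrable_const
        integrable_da_price[OF assms] integrable_rt_price_imbalance[OF assms(1)])
qed

text \<open>Tower property: averaging a conditional expectation gives the plain expectation.\<close>

lemma integral_cond_rt_price:
  assumes "belief I i dmax P"
  shows "(\<integral>\<omega>. cond_rt_price R I i d P \<delta> \<omega> \<partial>P)
    = (\<integral>\<omega>. rt_price R (imbalance I i (d - \<delta>) (fst \<omega>) (snd \<omega>)) \<partial>P)"
proof -
  interpret prob_space P using assms by (simp add: belief_def)
  note fst = measurable_belief_coordinates(1)[OF assms]
  then have "fst \<in> space P \<rightarrow> space (PiM (I - {i}) (\<lambda>_. borel))"
    using measurable_space by (intro funcsetI)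
  \<comment> \<open>Measurability of \<open>fst\<close> puts its preimages into the events of
    \<open>P\<close>.\<close>
  then have "subalgebra P (others_algebra I i P)"
    using measurable_sets[OF fst]
    by (auto simp: subalgebra_def others_algebra_def sets_vimage_algebra2)
  then interpret finite_measure_subalgebra P "others_algebra I i P"
    by unfold_locales
  show ?thesis
    using real_cond_exp_int(2)[OF integrable_rt_price_imbalance[OF assms]]
    by (simp add: cond_rt_price_def case_prod_unfold)
qed

text \<open>A real supremum dominates its members only if the set is bounded above; the uniform
  price bound provides this.\<close>

lemma integral_rt_price_le_beta_max:
  assumes "belief I i dmax P" "\<delta> \<in> {0..d}"
  shows "(\<integral>\<omega>. rt_price R (imbalance I i (d - \<delta>) (fst \<omega>) (snd \<omega>)) \<partial>P) \<le> beta_max R I i d P"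
proof -
  interpret prob_space P using assms by (simp add: belief_def)
  have "(\<integral>\<omega>. cond_rt_price R I i d P \<delta> \<omega> \<partial>P) \<le> (\<Sum>j=1..rt_size R. \<bar>rt_cost R j\<bar>)" for \<delta>
    unfolding integral_cond_rt_price[OF assms(1)]
    using rt_price_abs_le[of R]
    by (intro integral_le_const integrable_rt_price_imbalance[OF assms(1)] AE_I2)
       (simp add: abs_le_iff)
  then show ?thesis
    unfolding beta_max_def integral_cond_rt_price[OF assms(1), symmetric]
    by (intro cSUP_upper assms(2) bdd_aboveI2)
qed

text \<open>Turns the indicator from the pointwise profit bound into the probability of the crossing
  event.\<close>

lemma integral_crossing_indicator:
  assumes "belief I i dmax P"
  shows "integrable P (\<lambda>\<omega>. indicator {rt_brk R (j + 1) - d..<rt_brk R (j + 1)}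
      (imbalance I i d (fst \<omega>) (snd \<omega>)) :: real)" (is "integrable P ?f")
    and "(\<integral>\<omega>. indicator {rt_brk R (j + 1) - d..<rt_brk R (j + 1)}
      (imbalance I i d (fst \<omega>) (snd \<omega>)) \<partial>P) = crossing_prob R I i j d P"
proof -
  interpret prob_space P using assms by (simp add: belief_def)
  note [measurable] = measurable_imbalance[OF assms]
  let ?S = "{\<omega> \<in> space P. imbalance I i d (fst \<omega>) (snd \<omega>)
      \<in> {rt_brk R (j + 1) - d..<rt_brk R (j + 1)}}"
  have S [measurable]: "?S \<in> sets P" by measurable
  have eq: "?f \<omega> = indicator ?S \<omega>" if "\<omega> \<in> space P" for \<omega>
    using that by (simp add: indicator_def)
  have int: "integrable P (indicator ?S :: _ \<Rightarrow> real)"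
    using S by (simp add: less_top[symmetric])
  show "integrable P ?f"
    by (rule Bochner_Integration.integrable_cong[THEN iffD2, OF refl eq int])
  show "(\<integral>\<omega>. ?f \<omega> \<partial>P) = crossing_prob R I i j d P"
    using Bochner_Integration.integral_cong[OF refl eq, of P] S
    by (simp add: crossing_prob_def)
qed

section \<open>Gain from reporting zero demand\<close>

lemma zero_report_gain:
  assumes P: "belief I i dmax P" and A: "da_wf A" and R: "rt_wf R"
    and d: "0 \<le> d"
    and a: "prosumer R a" "j \<in> {1..<rt_size R}" "a j = 1"
    and range: "imbalance_in_range R I i d P"
    and q: "q * d \<le> crossing_prob R I i j d P"
  shows "eps_prosumer d (gap_value R j) q (beta_max R I i d P)
    \<le> expected_utility A R I i a v P d 0 - expected_utility A R I i a v P d d"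
proof -
  have j: "j \<in> {1..rt_size R}" using a by auto
  let ?\<rho> = "\<lambda>d' \<omega>. imbalance I i d' (fst \<omega>) (snd \<omega>)"
  let ?U = "\<lambda>d' \<omega>. prosumer_utility A R I i a v d d' (fst \<omega>) (snd \<omega>)"
  let ?ind = "\<lambda>\<omega>. indicator {rt_brk R (j + 1) - d..<rt_brk R (j + 1)} (?\<rho> d \<omega>) :: real"
  have U: "integrable P (?U d')" for d'
    unfolding prosumer_utility_single_unit[where l = j, OF a(1) j a(3)]
    by (intro Bochner_Integration.integrable_add integrable_utility[OF P A]
        integrable_unit_profit_imbalance[OF P R j])
  note price = integrable_rt_price_imbalance[OF P]
  note crossing = integral_crossing_indicator[OF P]
  \<comment> \<open>At report 0 the DA payment vanishes, at report \<open>d\<close> the RT payment.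
    The difference is the saved DA payment, minus the RT payment, plus the change in unit
    profit.\<close>
  have pointwise: "gap_value R j * ?ind \<omega> - rt_price R (?\<rho> 0 \<omega>) * d \<le> ?U 0 \<omega> - ?U d \<omega>"
    if "?\<rho> d \<omega> \<in> {0..<rt_brk R (rt_size R + 1)}" "?\<rho> 0 \<omega> \<in> {0..<rt_brk R (rt_size R + 1)}" for \<omega>
  proof -
    have shift: "?\<rho> 0 \<omega> = ?\<rho> d \<omega> + d" by (simp add: imbalance_def)
    have "0 \<le> da_price A I i d (fst \<omega>) * d"
      using d da_inv_supply_nonneg[OF A] by (simp add: da_price_def)
    then show ?thesis
      using unit_profit_crossing[OF R a(2), of "?\<rho> d \<omega>" d] that d
      unfolding prosumer_utility_single_unit[where l = j, OF a(1) j a(3)] shift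
      by (simp add: utility_def shift)
  qed
  \<comment> \<open>The range condition is taken at the two reports compared, \<open>d' = d\<close>
    and \<open>d' = 0\<close>.\<close>
  have "AE \<omega> in P. ?\<rho> d \<omega> \<in> {0..<rt_brk R (rt_size R + 1)}"
    and "AE \<omega> in P. ?\<rho> 0 \<omega> \<in> {0..<rt_brk R (rt_size R + 1)}"
    using range d by (auto simp: imbalance_in_range_def)
  then have
    "AE \<omega> in P. gap_value R j * ?ind \<omega> - rt_price R (?\<rho> 0 \<omega>) * d \<le> ?U 0 \<omega> - ?U d \<omega>"
    by eventually_elim (rule pointwise)
  then have "(\<integral>\<omega>. gap_value R j * ?ind \<omega> - rt_price R (?\<rho> 0 \<omega>) * d \<partial>P)
      \<le> (\<integral>\<omega>. ?U 0 \<omega> - ?U d \<omega> \<partial>P)"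
    by (intro integral_mono_AE Bochner_Integration.integrable_diff integrable_mult_left
        integrable_mult_right U price crossing)
  then have "gap_value R j * crossing_prob R I i j d P - (\<integral>\<omega>. rt_price R (?\<rho> 0 \<omega>) \<partial>P) * d
      \<le> expected_utility A R I i a v P d 0 - expected_utility A R I i a v P d d"
    using U price crossing by (simp add: expected_utility_def case_prod_unfold)
  \<comment> \<open>Report 0 is the under-report \<open>\<delta> = d\<close>, one of the candidates
    in the supremum.\<close>
  moreover have "(\<integral>\<omega>. rt_price R (?\<rho> 0 \<omega>) \<partial>P) * d \<le> beta_max R I i d P * d"
    using integral_rt_price_le_beta_max[OF P, of d d R] d by (simp add: mult_right_mono)
  moreover have "gap_value R j * (q * d) \<le> gap_value R j * crossing_prob R I i j d P"
  proof -
    \<comment> \<open>The sign allows the crossing probability to be replaced by its lower bound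
      \<open>q * d\<close>.\<close>
    have "0 \<le> gap_value R j"
      using R a(2) rt_cost_mono[OF R, of j "j + 1"]
      by (auto simp: gap_value_def rt_wf_def less_imp_le)
    then show ?thesis using q by (rule mult_left_mono[rotated])
  qed
  ultimately show ?thesis
    by (simp add: eps_prosumer_def algebra_simps)
qed

theorem theorem2:
  fixes I :: "'i set"
    and A :: da_market and R :: rt_market
    and v d q :: "'i \<Rightarrow> real" and dmax :: real
    and \<alpha> :: "'i \<Rightarrow> nat \<Rightarrow> real"
    and j0 :: "'i \<Rightarrow> nat"
    and P :: "'i \<Rightarrow> (('i \<Rightarrow> real) \<times> real) measure"
    and m :: nat and l \<kappa> r :: real
  assumes "finite I" and "da_wf A" and "rt_wf R"
    and "\<And>i. i \<in> I \<Longrightarrow> 0 < v i"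
    and "\<And>i. i \<in> I \<Longrightarrow> d i \<in> {0..dmax}"
    and "\<And>i. i \<in> I \<Longrightarrow> belief I i dmax (P i)"
    and "\<exists>i\<in>I. prosumer R (\<alpha> i)"
    and "\<And>i. i \<in> I \<Longrightarrow> prosumer R (\<alpha> i) \<Longrightarrow> j0 i \<in> {1..<rt_size R} \<and> \<alpha> i (j0 i) = 1"
    and "\<And>i. i \<in> I \<Longrightarrow> prosumer R (\<alpha> i) \<Longrightarrow> imbalance_in_range R I i (d i) (P i)"
    and "\<And>i. i \<in> I \<Longrightarrow> prosumer R (\<alpha> i) \<Longrightarrow>
           0 < q i \<and> q i * d i \<le> crossing_prob R I i (j0 i) (d i) (P i)"
    and A1: "\<And>i. i \<in> I \<Longrightarrow> prosumer R (\<alpha> i) \<Longrightarrow> certain_allocation A I i (d i) (P i)"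
    and A2: "\<And>i. i \<in> I \<Longrightarrow> prosumer R (\<alpha> i) \<Longrightarrow> rt_more_expensive A R I i (d i) (P i)"
    and A3: "0 < l" "\<kappa> \<in> {0<..1}"
            "\<And>i. i \<in> I \<Longrightarrow> prosumer R (\<alpha> i) \<Longrightarrow> spread_demands I i (P i) m l \<kappa>"
    and A4: "r \<in> {0<..1}" "r * real (card I) \<le> real m"
  shows "\<exists>i\<in>I. prosumer R (\<alpha> i) \<and>
           (\<exists>d'\<in>{0..d i}.
              expected_utility A R I i (\<alpha> i) (v i) (P i) (d i) d'
              - expected_utility A R I i (\<alpha> i) (v i) (P i) (d i) (d i)
              \<ge> eps_prosumer (d i) (gap_value R (j0 i)) (q i) (beta_max R I i (d i) (P i)))"
proof -
  obtain i where i: "i \<in> I" "prosumer R (\<alpha> i)" using assms(7) by blast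
  \<comment> \<open>Any prosumer serves as the witness, with the zero report; it is admissible since
    true demand is nonnegative.\<close>
  have "0 \<in> {0..d i}" using assms(5)[OF i(1)] by simp
  moreover have "eps_prosumer (d i) (gap_value R (j0 i)) (q i) (beta_max R I i (d i) (P i))
      \<le> expected_utility A R I i (\<alpha> i) (v i) (P i) (d i) 0
        - expected_utility A R I i (\<alpha> i) (v i) (P i) (d i) (d i)"
    using assms(5,6)[OF i(1)] assms(8-10)[OF i] i(2)
    by (intro zero_report_gain[OF _ \<open>da_wf A\<close> \<open>rt_wf R\<close>]) auto
  ultimately show ?thesis using i by blast
qed

end
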